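(* Let $W$ be an irreducible $T$-module with endpoint $r$ and diameter $d=D-2r$. Then the following hold for $0\le i,j\le d$ and nonzero vectors $u\in E_rW$, $u^*\in E^*_rW$, $u^{\varepsilon}\in E^{\varepsilon}_rW$. (i) $\langle E_{r+i}u^{\varepsilon},E_{r+j}u^*\rangle=\delta_{ij}\,\mathbf{i}^i\binom{d}{i}(1+\mathbf{i})^{-d}\langle u^{\varepsilon},u^*\rangle$. (ii) $\langle E^*_{r+i}u,E^*_{r+j}u^{\varepsilon}\rangle=\delta_{ij}\,\mathbf{i}^i\binom{d}{i}(1+\mathbf{i})^{-d}\langle u,u^{\varepsilon}\rangle$. (iii) $\langle E^{\varepsilon}_{r+i}u^*,E^{\varepsilon}_{r+j}u\rangle=\delta_{ij}\,\mathbf{i}^i\binom{d}{i}(1+\mathbf{i})^{-d}\langle u^*,u\rangle$.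
   Context: Let $D$ be a positive integer and let $Q_D$ be the $D$-cube: the graph with vertex set $X=\{0,1\}^D$, two vertices being adjacent iff they differ in exactly one coordinate; $\partial$ denotes path-length distance. $\mathrm{Mat}_X(\mathbb{C})$ is the algebra of complex matrices with rows and columns indexed by $X$, acting on $V=\mathbb{C}^X$ (column vectors) by left multiplication. $V$ carries the Hermitian inner product $\langle v,w\rangle=v^t\overline{w}$ (linear in the first argument). Write $\mathbf{i}^2=-1$ (the bold $\mathbf{i}$ is the imaginary unit; the plain $i$ is an index). Let $A$ be the adjacency matrix of $Q_D$. Fix $x=(0,0,\ldots,0)\in X$. Let $A^*$ be the diagonal matrix in $\mathrm{Mat}_X(\mathbb{C})$ with $(y,y)$-entry $D-2\partial(x,y)$ for $y\in X$, and let $A^{\varepsilon}=-\mathbf{i}(AA^*-A^*A)/2$. Let $T$ be the subalgebra of $\mathrm{Mat}_X(\mathbb{C})$ generated by $A$ and $A^*$. The eigenvalues of $A$ are $\theta_i=D-2i$ $(0\le i\le D)$. For $0\le i\le D$: $E_i=\prod_{0\le j\le D,\,j\ne i}\frac{A-\theta_jI}{\theta_i-\theta_j}$ is the primitive idempotent of $A$ for $\theta_i$ (the orthogonal projection onto the $\theta_i$-eigenspace of $A$); $E_i^*$ is the diagonal matrix with $(y,y)$-entry $1$ if $\partial(x,y)=i$ and $0$ otherwise; and $E_i^{\varepsilon}=P^{-1}E_iP$, where $P=P_1^{\otimes D}$ (Kronecker power, $P_{yz}=\prod_{k=1}^D(P_1)_{y_kz_k}$, invertible) with $P_1=\begin{pmatrix}1&1\\-\mathbf{i}&\mathbf{i}\end{pmatrix}$,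 rows and columns indexed by $0,1$ in that order. ($E_i^*$ and $E_i^{\varepsilon}$ are the primitive idempotents of $A^*$ and $A^{\varepsilon}$ for the eigenvalue $D-2i$.) A $T$-module is a subspace $W\subseteq V$ with $BW\subseteq W$ for all $B\in T$; it is irreducible if $W\ne0$ and it contains no $T$-modules other than $0$ and $W$. The endpoint of an irreducible $T$-module $W$ is $r=\min\{i\mid 0\le i\le D,\ E_i^*W\neq0\}$ (it is known that also $r=\min\{i\mid E_iW\ne0\}$), and its diameter is $d=|\{i\mid 0\le i\le D,\ E_i^*W\ne0\}|-1$; it is known that $d=D-2r$ and $0\le r\le D/2$. *)

theory Defs
  imports "HOL-Analysis.Analysis"
begin

text \<open>
  The \<open>D\<close>-cube is rendered with \<open>D = CARD('n)\<close> for an arbitrary finite index type \<open>'n\<close>; a vertex is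
  an element of \<^typ>\<open>bool ^ 'n\<close>, with \<^term>\<open>False\<close> and \<^term>\<open>True\<close> standing for the coordinates
  \<open>0\<close> and \<open>1\<close>.
\<close>

type_synonym 'n vertex = "bool ^ 'n"
type_synonym 'n cube_vec = "complex ^ 'n vertex"
type_synonym 'n cube_mat = "complex ^ 'n vertex ^ 'n vertex"

definition cube_adj :: "'n::finite vertex \<Rightarrow> 'n vertex \<Rightarrow> bool" where
  "cube_adj y z \<longleftrightarrow> (\<exists>!k. y $ k \<noteq> z $ k)"

text \<open>Path-length distance: the least length of a walk in the graph.\<close>

definition cube_dist :: "'n::finite vertex \<Rightarrow> 'n vertex \<Rightarrow> nat" where
  "cube_dist y z = (LEAST m. (y, z) \<in> {(a, b). cube_adj a b} ^^ m)"

definition base_vertex :: "'n::finite vertex" where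
  "base_vertex = (\<chi> k. False)"

definition hermitian :: "'n::finite cube_vec \<Rightarrow> 'n cube_vec \<Rightarrow> complex" where
  "hermitian v w = (\<Sum>y\<in>UNIV. v $ y * cnj (w $ y))"

definition cscale :: "complex \<Rightarrow> 'n::finite cube_mat \<Rightarrow> 'n cube_mat" where
  "cscale c M = map_matrix (\<lambda>a. c * a) M"

definition A_mat :: "'n::finite cube_mat" where
  "A_mat = (\<chi> y z. if cube_adj y z then 1 else 0)"

definition theta :: "'n::finite itself \<Rightarrow> nat \<Rightarrow> complex" where
  "theta _ i = of_nat CARD('n) - 2 * of_nat i"

definition Astar_mat :: "'n::finite cube_mat" where
  "Astar_mat = (\<chi> y z. if y = z then of_nat CARD('n) - 2 * of_nat (cube_dist base_vertex y) else 0)"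

definition subalgebra :: "'n::finite cube_mat set \<Rightarrow> bool" where
  "subalgebra S \<longleftrightarrow> mat 1 \<in> S \<and> (\<forall>B\<in>S. \<forall>C\<in>S. B + C \<in> S) \<and> (\<forall>c. \<forall>B\<in>S. cscale c B \<in> S)
     \<and> (\<forall>B\<in>S. \<forall>C\<in>S. B ** C \<in> S)"

definition T_alg :: "'n::finite cube_mat set" where
  "T_alg = subalgebra hull {A_mat, Astar_mat}"

text \<open>
  The primitive idempotents of \<^const>\<open>A_mat\<close>. In type \<^typ>\<open>'n cube_mat\<close> the class multiplication
  is entrywise, so the product of matrices over \<open>j \<noteq> i\<close> is a fold of \<open>**\<close> along a list; the
  factors commute, so the order is immaterial.
\<close>

definition E_mat :: "nat \<Rightarrow> 'n::finite cube_mat" where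
  "E_mat i = foldr
     (\<lambda>j M. cscale (1 / (theta TYPE('n) i - theta TYPE('n) j)) (A_mat - cscale (theta TYPE('n) j) (mat 1)) ** M)
     (filter (\<lambda>j. j \<noteq> i) [0..<Suc CARD('n)]) (mat 1)"

definition Estar_mat :: "nat \<Rightarrow> 'n::finite cube_mat" where
  "Estar_mat i = (\<chi> y z. if y = z \<and> cube_dist base_vertex y = i then 1 else 0)"

definition P1_mat :: "complex ^ bool ^ bool" where
  "P1_mat = (\<chi> a b. if \<not> a then 1 else if b then \<i> else - \<i>)"

definition P_mat :: "'n::finite cube_mat" where
  "P_mat = (\<chi> y z. \<Prod>k\<in>UNIV. P1_mat $ (y $ k) $ (z $ k))"

definition Eeps_mat :: "nat \<Rightarrow> 'n::finite cube_mat" where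
  "Eeps_mat i = matrix_inv P_mat ** E_mat i ** P_mat"

definition T_module :: "'n::finite cube_vec set \<Rightarrow> bool" where
  "T_module W \<longleftrightarrow> vec.subspace W \<and> (\<forall>B\<in>T_alg. \<forall>w\<in>W. B *v w \<in> W)"

definition irreducible_T_module :: "'n::finite cube_vec set \<Rightarrow> bool" where
  "irreducible_T_module W \<longleftrightarrow>
     T_module W \<and> W \<noteq> {0} \<and> (\<forall>U. T_module U \<and> U \<subseteq> W \<longrightarrow> U = {0} \<or> U = W)"

definition mat_image :: "'n::finite cube_mat \<Rightarrow> 'n cube_vec set \<Rightarrow> 'n cube_vec set" where
  "mat_image B W = (\<lambda>w. B *v w) ` W"

definition dual_support :: "'n::finite cube_vec set \<Rightarrow> nat set" where
  "dual_support W = {i. i \<le> CARD('n) \<and> mat_image (Estar_mat i) W \<noteq> {0}}"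

definition endpoint :: "'n::finite cube_vec set \<Rightarrow> nat" where
  "endpoint W = Min (dual_support W)"

definition diameter_T :: "'n::finite cube_vec set \<Rightarrow> nat" where
  "diameter_T W = card (dual_support W) - 1"

end

theory Submission
  imports Defs
begin

text \<open>
  The matrices \<open>A\<close>, \<open>A*\<close>, \<open>A\<^sup>\<epsilon>\<close> satisfy the relations \<open>[X, Y] = 2\<i> Z\<close> of \<open>su(2)\<close> cyclically, because
  conjugation by \<open>P\<close> permutes them cyclically. Thus all three identities are instances of a single
  one about an irreducible module \<open>W\<close> of such a triple \<open>X, Y, Z\<close>.

  The Casimir element \<open>X\<^sup>2 + Y\<^sup>2 + Z\<^sup>2\<close> acts on \<open>W\<close> as a scalar, which is read off on an extreme weight
  vector of any of the three. Hence the weights of \<open>X\<close>, of \<open>Y\<close> and of \<open>Z\<close> on \<open>W\<close> all form the same string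
  \<open>d, d - 2, \<dots>, -d\<close>. Let \<open>v\<close> and \<open>w\<close> be the vectors of highest weight for \<open>Z\<close> and \<open>Y\<close>, let \<open>E\<^sub>k\<close> be the
  projection on the weight \<open>d - 2k\<close> of \<open>X\<close>, and put \<open>f k = \<langle>E\<^sub>k v, w\<rangle>\<close>. Pairing \<open>(Y + \<i>Z) E\<^sub>k v = E\<^bsub>k-1\<^esub> (Y + \<i>Z) v\<close>
  with \<open>w\<close> and using that \<open>v\<close> and \<open>w\<close> are killed by their raising operators gives
  \<open>k f k = \<i> (d - k + 1) f (k - 1)\<close>, so \<open>f k = \<i>\<^sup>k (d choose k) f 0\<close>. The sum of the \<open>f k\<close> is \<open>\<langle>v, w\<rangle>\<close>,
  whence \<open>(1 + \<i>)\<^sup>d f 0 = \<langle>v, w\<rangle>\<close>.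
\<close>

text \<open>The index ranges over all naturals; orthogonality together with the resolution of the
  identity forces \<open>E i\<close> to act as zero for \<open>i > CARD('n)\<close>.\<close>

definition eigenprojections :: "'n::finite cube_mat \<Rightarrow> (nat \<Rightarrow> 'n cube_mat) \<Rightarrow> bool" where
  "eigenprojections X E \<longleftrightarrow>
     (\<forall>i v. X *v (E i *v v) = theta TYPE('n) i *s (E i *v v)) \<and>
     (\<forall>i j v. E i *v (E j *v v) = (if i = j then E i *v v else 0)) \<and>
     (\<forall>v. (\<Sum>i\<le>CARD('n). E i *v v) = v)"

definition selfadjoint :: "'n::finite cube_mat \<Rightarrow> bool" where
  "selfadjoint X \<longleftrightarrow> (\<forall>v w. hermitian (X *v v) w = hermitian v (X *v w))"

definition invariant :: "'n::finite cube_mat \<Rightarrow> 'n cube_vec set \<Rightarrow> bool" where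
  "invariant X W \<longleftrightarrow> (\<forall>w\<in>W. X *v w \<in> W)"

text \<open>
  A weight is recorded by its index: \<open>i\<close> stands for the eigenvalue \<open>D - 2i\<close>, so raising an eigenvalue
  lowers the index.
\<close>

definition weights :: "(nat \<Rightarrow> 'n::finite cube_mat) \<Rightarrow> 'n cube_vec set \<Rightarrow> nat set" where
  "weights E W = {i. i \<le> CARD('n) \<and> (\<exists>w\<in>W. E i *v w \<noteq> 0)}"

section \<open>Eigenvalue arithmetic and the Hermitian form\<close>

lemma theta_eq_iff [simp]: "theta TYPE('n::finite) i = theta TYPE('n) j \<longleftrightarrow> i = j"
  by (auto simp: theta_def)

lemma theta_Suc: "theta t (Suc i) = theta t i - 2"
  by (simp add: theta_def)

lemma theta_plus_2_eq_iff: "theta TYPE('n::finite) i + 2 = theta TYPE('n) j \<longleftrightarrow> i = Suc j"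
  using theta_eq_iff[of i "Suc j", where 'n = 'n] unfolding theta_Suc by (simp add: eq_diff_eq)

lemma cnj_theta [simp]: "cnj (theta t i) = theta t i"
  by (simp add: theta_def)

lemma hermitian_add_left: "hermitian (v + w) z = hermitian v z + hermitian w z"
  by (simp add: hermitian_def algebra_simps sum.distrib)

lemma hermitian_add_right: "hermitian z (v + w) = hermitian z v + hermitian z w"
  by (simp add: hermitian_def algebra_simps sum.distrib)

lemma hermitian_scale_left: "hermitian (c *s v) z = c * hermitian v z"
  by (simp add: hermitian_def algebra_simps sum_distrib_left)

lemma hermitian_scale_right: "hermitian z (c *s v) = cnj c * hermitian z v"
  by (simp add: hermitian_def algebra_simps sum_distrib_left)

lemma hermitian_zero [simp]: "hermitian 0 z = 0" "hermitian z 0 = 0"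
  by (simp_all add: hermitian_def)

lemma hermitian_sum_left: "hermitian (\<Sum>i\<in>I. f i) z = (\<Sum>i\<in>I. hermitian (f i) z)"
  by (induction I rule: infinite_finite_induct) (simp_all add: hermitian_add_left)

lemma hermitian_sum_right: "hermitian z (\<Sum>i\<in>I. f i) = (\<Sum>i\<in>I. hermitian z (f i))"
  by (induction I rule: infinite_finite_induct) (simp_all add: hermitian_add_right)

lemma matrix_vector_mult_sum: "M *v (\<Sum>i\<in>I. f i) = (\<Sum>i\<in>I. M *v f i)"
  for M :: "'n::finite cube_mat"
  by (induction I rule: infinite_finite_induct) (simp_all add: matrix_vector_right_distrib)

lemmas matvec_linear = matrix_vector_right_distrib matrix_vector_mult_diff_distrib
  vector_scalar_commute

subsection \<open>Irreducible modules of an \<open>su(2)\<close> triple\<close>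

text \<open>The relations are given as actions on vectors, ready for linear rewriting.
  \<open>inv_proj\<close> will hold because the projections are polynomials in \<open>X\<close>,
  \<open>Y\<close>, \<open>Z\<close>.\<close>

locale su2_module =
  fixes X Y Z :: "'n::finite cube_mat" and PX PY PZ :: "nat \<Rightarrow> 'n cube_mat"
    and W :: "'n cube_vec set"
  assumes XY: "X *v (Y *v v) = Y *v (X *v v) + (2 * \<i>) *s (Z *v v)"
    and YZ: "Y *v (Z *v v) = Z *v (Y *v v) + (2 * \<i>) *s (X *v v)"
    and ZX: "Z *v (X *v v) = X *v (Z *v v) + (2 * \<i>) *s (Y *v v)"
    and eigen: "eigenprojections X PX" "eigenprojections Y PY" "eigenprojections Z PZ"
    and selfadj: "selfadjoint X" "selfadjoint Y" "selfadjoint Z"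
    and subspace: "vec.subspace W"
    and inv: "invariant X W" "invariant Y W" "invariant Z W"
    and inv_proj: "\<And>i. invariant (PX i) W" "\<And>i. invariant (PY i) W" "\<And>i. invariant (PZ i) W"
    and nonzero: "W \<noteq> {0}"
    and irred: "\<And>U. \<lbrakk>vec.subspace U; invariant X U; invariant Y U; invariant Z U; U \<subseteq> W\<rbrakk>
                  \<Longrightarrow> U = {0} \<or> U = W"
begin

text \<open>The axioms are cyclically symmetric, so each result about \<open>X\<close> becomes
  available for \<open>Y\<close> and \<open>Z\<close> by interpretation.\<close>

lemma rotate: "su2_module Y Z X PY PZ PX W"
  using YZ ZX XY eigen selfadj subspace inv inv_proj nonzero irred
  by unfold_locales auto

lemma W_closed:
  "w \<in> W \<Longrightarrow> X *v w \<in> W" "w \<in> W \<Longrightarrow> Y *v w \<in> W" "w \<in> W \<Longrightarrow> Z *v w \<in> W"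
  "w \<in> W \<Longrightarrow> PX i *v w \<in> W"
  using inv inv_proj by (auto simp: invariant_def)

lemma PX_eigen: "X *v (PX i *v v) = theta TYPE('n) i *s (PX i *v v)"
  and PX_PX: "PX i *v (PX j *v v) = (if i = j then PX i *v v else 0)"
  and PX_sum: "(\<Sum>i\<le>CARD('n). PX i *v v) = v"
  using eigen(1) by (auto simp: eigenprojections_def)

text \<open>Expand \<open>v\<close> into its components before applying \<open>X\<close>. Beyond
  \<open>CARD('n)\<close> no component matches, whence the coefficient 0.\<close>

lemma PX_X: "PX i *v (X *v v) = (if i \<le> CARD('n) then theta TYPE('n) i else 0) *s (PX i *v v)"
proof -
  have "PX i *v (X *v v) = PX i *v (X *v (\<Sum>j\<le>CARD('n). PX j *v v))"
    by (simp add: PX_sum)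
  also have "\<dots> = (\<Sum>j\<le>CARD('n). theta TYPE('n) j *s (if i = j then PX i *v v else 0))"
    by (simp add: matrix_vector_mult_sum PX_eigen PX_PX vector_scalar_commute del: if_cancel)
  also have "\<dots> = (\<Sum>j\<le>CARD('n). if i = j then theta TYPE('n) j *s (PX i *v v) else 0)"
    by (intro sum.cong) auto
  finally show ?thesis by simp
qed

lemma PX_eigenvector_eq_0:
  assumes "X *v v = a *s v" "i \<le> CARD('n)" "a \<noteq> theta TYPE('n) i"
  shows "PX i *v v = 0"
proof -
  have "a *s (PX i *v v) = theta TYPE('n) i *s (PX i *v v)"
    using PX_X[of i v] assms by (simp add: vector_scalar_commute)
  then show ?thesis using assms(3) by simp
qed

text \<open>Eigenspaces of the self-adjoint \<open>X\<close> for distinct real eigenvalues are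
  orthogonal; expanding \<open>w\<close> into components then leaves only the one of index
  \<open>i\<close>.\<close>

lemma hermitian_PX_left:
  assumes "i \<le> CARD('n)"
  shows "hermitian (PX i *v v) (PX j *v w) = (if i = j then hermitian (PX i *v v) w else 0)"
proof -
  have *: "hermitian (PX i *v v) (PX j *v w) = 0" if "i \<noteq> j" for i j
  proof -
    have "theta TYPE('n) i * hermitian (PX i *v v) (PX j *v w)
        = theta TYPE('n) j * hermitian (PX i *v v) (PX j *v w)"
      using selfadj(1) PX_eigen[of i v] PX_eigen[of j w]
      unfolding selfadjoint_def
      by (metis (no_types, lifting) hermitian_scale_left hermitian_scale_right cnj_theta)
    then show ?thesis using that by simp
  qed
  have "hermitian (PX i *v v) w = (\<Sum>k\<le>CARD('n). hermitian (PX i *v v) (PX k *v w))"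
    by (metis PX_sum hermitian_sum_right)
  also have "\<dots> = (\<Sum>k\<le>CARD('n). if i = k then hermitian (PX i *v v) (PX i *v w) else 0)"
    by (intro sum.cong) (auto simp: *)
  finally have "hermitian (PX i *v v) w = hermitian (PX i *v v) (PX i *v w)" if "i \<le> CARD('n)"
    using that by simp
  then show ?thesis using assms * by auto
qed

section \<open>Ladder operators and the Casimir element\<close>

definition up where "up v = Y *v v + \<i> *s (Z *v v)"
definition down where "down v = Y *v v - \<i> *s (Z *v v)"
definition casimir where "casimir v = X *v (X *v v) + Y *v (Y *v v) + Z *v (Z *v v)"

text \<open>The relations give \<open>[X, Y + \<i> Z] = 2 (Y + \<i> Z)\<close>, so \<open>up\<close>
  raises the eigenvalue by 2 and lowers its index by one.\<close>

lemma X_up: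
  assumes "X *v v = a *s v"
  shows "X *v up v = (a + 2) *s up v"
  using XY[of v] ZX[of v] assms
  by (simp add: up_def matvec_linear vec_eq_iff algebra_simps)

lemma X_down:
  assumes "X *v v = a *s v"
  shows "X *v down v = (a - 2) *s down v"
  using XY[of v] ZX[of v] assms
  by (simp add: down_def matvec_linear vec_eq_iff algebra_simps)

text \<open>\<open>(Y - \<i> Z) (Y + \<i> Z) = Y^2 + Z^2 + \<i> [Y, Z]\<close>, and
  \<open>\<i> [Y, Z] = - 2 X\<close>. On an eigenvector killed by \<open>up\<close> the Casimir
  value depends on the eigenvalue alone.\<close>

lemma casimir_up: "casimir v = X *v (X *v v) + 2 *s (X *v v) + down (up v)"
  using YZ[of v]
  by (simp add: up_def down_def casimir_def matvec_linear vec_eq_iff algebra_simps)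

lemma casimir_down: "casimir v = X *v (X *v v) - 2 *s (X *v v) + up (down v)"
  using YZ[of v]
  by (simp add: up_def down_def casimir_def matvec_linear vec_eq_iff algebra_simps)

lemma casimir_commutes:
  "casimir (X *v v) = X *v casimir v"
  "casimir (Y *v v) = Y *v casimir v"
  "casimir (Z *v v) = Z *v casimir v"
  by (simp_all add: casimir_def matvec_linear XY YZ ZX vec_eq_iff algebra_simps)

lemma casimir_zero: "casimir 0 = 0"
  and casimir_add: "casimir (v + w) = casimir v + casimir w"
  and casimir_scale: "casimir (b *s v) = b *s casimir v"
  by (simp_all add: casimir_def matvec_linear vec_eq_iff algebra_simps)

text \<open>Schur's argument: an eigenspace of the Casimir element in \<open>W\<close> is a
  submodule, and a nonzero one is all of \<open>W\<close>.\<close>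

lemma casimir_scalar:
  assumes "v \<in> W" "v \<noteq> 0" "casimir v = c *s v" "w \<in> W"
  shows "casimir w = c *s w"
proof -
  let ?U = "{w \<in> W. casimir w = c *s w}"
  have "?U = {0} \<or> ?U = W"
  proof (rule irred)
    show "vec.subspace ?U"
      using subspace unfolding vec.subspace_def
      by (auto simp: casimir_add casimir_scale casimir_zero vector_add_ldistrib vector_smult_assoc mult.commute)
  qed (auto simp: invariant_def casimir_commutes matvec_linear W_closed)
  then show ?thesis using assms by auto
qed

lemma up_down_W:
  assumes "v \<in> W"
  shows "up v \<in> W" "down v \<in> W"
  using assms subspace
  by (auto simp: up_def down_def W_closed vec.subspace_add vec.subspace_diff vec.subspace_scale)

section \<open>Extreme weights and the Casimir scalar\<close>

lemma eigenvalue_in_weights: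
  assumes "v \<in> W" "v \<noteq> 0" "X *v v = a *s v"
  obtains i where "i \<in> weights PX W" "a = theta TYPE('n) i"
proof -
  obtain i where "i \<le> CARD('n)" "PX i *v v \<noteq> 0"
    using PX_sum[of v] assms(2) by (metis (mono_tags, lifting) atMost_iff sum.neutral)
  then show ?thesis
    using assms PX_eigenvector_eq_0 by (intro that[of i]) (auto simp: weights_def)
qed

lemma weight_vector:
  assumes "i \<in> weights PX W"
  obtains v where "v \<in> W" "v \<noteq> 0" "X *v v = theta TYPE('n) i *s v"
  using assms PX_eigen W_closed(4) unfolding weights_def by blast

lemma finite_weights: "finite (weights PX W)"
  by (simp add: weights_def)

lemma weights_nonempty: "weights PX W \<noteq> {}"
proof -
  obtain w where "w \<in> W" "w \<noteq> 0"
    using nonzero vec.subspace_0[OF subspace] by blast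
  moreover obtain i where "i \<le> CARD('n)" "PX i *v w \<noteq> 0"
    using PX_sum[of w] \<open>w \<noteq> 0\<close> by (metis (mono_tags, lifting) atMost_iff sum.neutral)
  ultimately show ?thesis by (auto simp: weights_def)
qed

text \<open>The least index is the largest eigenvalue; a nonzero \<open>up v\<close> would have an
  eigenvalue larger by 2.\<close>

lemma up_lowest:
  assumes "v \<in> W" "X *v v = theta TYPE('n) (Min (weights PX W)) *s v"
  shows "up v = 0"
proof (rule ccontr)
  assume "up v \<noteq> 0"
  then obtain i where i: "i \<in> weights PX W" "theta TYPE('n) (Min (weights PX W)) + 2 = theta TYPE('n) i"
    using eigenvalue_in_weights[OF up_down_W(1)[OF assms(1)] _ X_up[OF assms(2)]] by metis
  then show False
    using Min_le[OF finite_weights i(1)] by (simp add: theta_plus_2_eq_iff)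
qed

lemma down_highest:
  assumes "v \<in> W" "X *v v = theta TYPE('n) (Max (weights PX W)) *s v"
  shows "down v = 0"
proof (rule ccontr)
  assume "down v \<noteq> 0"
  then obtain i where i: "i \<in> weights PX W" "theta TYPE('n) (Max (weights PX W)) - 2 = theta TYPE('n) i"
    using eigenvalue_in_weights[OF up_down_W(2)[OF assms(1)] _ X_down[OF assms(2)]] by metis
  then show False
    using Max_ge[OF finite_weights i(1)] by (simp flip: theta_Suc)
qed

lemma casimir_Min:
  assumes "w \<in> W"
  shows "casimir w = ((theta TYPE('n) (Min (weights PX W)))\<^sup>2 + 2 * theta TYPE('n) (Min (weights PX W))) *s w"
proof -
  obtain v where v: "v \<in> W" "v \<noteq> 0" "X *v v = theta TYPE('n) (Min (weights PX W)) *s v"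
    using weight_vector Min_in[OF finite_weights weights_nonempty] by metis
  have "casimir v = ((theta TYPE('n) (Min (weights PX W)))\<^sup>2 + 2 * theta TYPE('n) (Min (weights PX W))) *s v"
    unfolding casimir_up up_lowest[OF v(1,3)]
    by (simp add: v(3) vector_scalar_commute down_def vec_eq_iff algebra_simps power2_eq_square)
  then show ?thesis using casimir_scalar v assms by blast
qed

lemma casimir_Max:
  assumes "w \<in> W"
  shows "casimir w = ((theta TYPE('n) (Max (weights PX W)))\<^sup>2 - 2 * theta TYPE('n) (Max (weights PX W))) *s w"
proof -
  obtain v where v: "v \<in> W" "v \<noteq> 0" "X *v v = theta TYPE('n) (Max (weights PX W)) *s v"
    using weight_vector Max_in[OF finite_weights weights_nonempty] by metis
  have "casimir v = ((theta TYPE('n) (Max (weights PX W)))\<^sup>2 - 2 * theta TYPE('n) (Max (weights PX W))) *s v"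
    unfolding casimir_down down_highest[OF v(1,3)]
    by (simp add: v(3) vector_scalar_commute up_def vec_eq_iff algebra_simps power2_eq_square)
  then show ?thesis using casimir_scalar v assms by blast
qed

text \<open>The Casimir scalar, read off at both ends, gives \<open>a^2 + 2 a = b^2 - 2 b\<close>
  for the largest eigenvalue \<open>a\<close> and the smallest \<open>b\<close>. As
  \<open>a \<ge> b\<close>, this forces \<open>a + b = 0\<close>.\<close>

lemma Min_plus_Max_weights: "Min (weights PX W) + Max (weights PX W) = CARD('n)"
proof -
  obtain w where w: "w \<in> W" "w \<noteq> 0"
    using nonzero vec.subspace_0[OF subspace] by blast
  \<comment> \<open>The eigenvalues are passed to the integers, where the factors can be compared by
    order.\<close>
  define a b where "a = int CARD('n) - 2 * int (Min (weights PX W))"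
    and "b = int CARD('n) - 2 * int (Max (weights PX W))"
  have "((theta TYPE('n) (Min (weights PX W)))\<^sup>2 + 2 * theta TYPE('n) (Min (weights PX W))) *s w
      = ((theta TYPE('n) (Max (weights PX W)))\<^sup>2 - 2 * theta TYPE('n) (Max (weights PX W))) *s w"
    using casimir_Min casimir_Max w(1) by metis
  then have "(theta TYPE('n) (Min (weights PX W)))\<^sup>2 + 2 * theta TYPE('n) (Min (weights PX W))
      = (theta TYPE('n) (Max (weights PX W)))\<^sup>2 - 2 * theta TYPE('n) (Max (weights PX W))"
    using w(2) by (simp only: vec.scale_right_imp_eq vector_mul_rcancel) simp
  moreover have "theta TYPE('n) (Min (weights PX W)) = of_int a"
      "theta TYPE('n) (Max (weights PX W)) = of_int b"
    by (simp_all add: theta_def a_def b_def)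
  ultimately have "(of_int (a\<^sup>2 + 2 * a) :: complex) = of_int (b\<^sup>2 - 2 * b)"
    by simp
  then have "a\<^sup>2 + 2 * a = b\<^sup>2 - 2 * b"
    by (simp only: of_int_eq_iff)
  then have "(a + b) * (a - b + 2) = 0"
    by (simp add: algebra_simps power2_eq_square)
  moreover have "b \<le> a"
    using Min_le[OF finite_weights Max_in[OF finite_weights weights_nonempty]]
    by (simp add: a_def b_def)
  ultimately show ?thesis by (simp add: a_def b_def)
qed

section \<open>Ladder operators on weight components; the weights form an interval\<close>

lemma PX_of_eigenvector:
  assumes "X *v v = theta TYPE('n) k *s v" "k \<le> CARD('n)"
  shows "PX k *v v = v"
proof -
  have "v = (\<Sum>j\<le>CARD('n). PX j *v v)" by (simp add: PX_sum)
  also have "\<dots> = (\<Sum>j\<le>CARD('n). if k = j then PX k *v v else 0)"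
    using PX_eigenvector_eq_0[OF assms(1)] by (intro sum.cong) auto
  finally show ?thesis using assms(2) by simp
qed

text \<open>Each \<open>up (PX j *v v)\<close> is an eigenvector for \<open>theta j + 2\<close>, so
  \<open>PX k\<close> retains only the term \<open>j = Suc k\<close>, which the bound on
  \<open>k\<close> keeps inside the sum.\<close>

lemma up_PX:
  assumes "Suc k \<le> CARD('n)"
  shows "up (PX (Suc k) *v v) = PX k *v up v"
proof -
  have up_PX: "X *v up (PX j *v v) = (theta TYPE('n) j + 2) *s up (PX j *v v)" for j
    by (rule X_up[OF PX_eigen])
  have "up v = up (\<Sum>j\<le>CARD('n). PX j *v v)" by (simp add: PX_sum)
  also have "\<dots> = (\<Sum>j\<le>CARD('n). up (PX j *v v))"
    by (simp add: up_def matrix_vector_mult_sum sum.distrib vec.scale_sum_right)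
  finally have "PX k *v up v = (\<Sum>j\<le>CARD('n). PX k *v up (PX j *v v))"
    by (simp add: matrix_vector_mult_sum)
  also have "\<dots> = (\<Sum>j\<le>CARD('n). if Suc k = j then PX k *v up (PX (Suc k) *v v) else 0)"
    using PX_eigenvector_eq_0[OF up_PX] assms by (intro sum.cong) (auto simp: theta_plus_2_eq_iff)
  also have "\<dots> = PX k *v up (PX (Suc k) *v v)" using assms by simp
  also have "\<dots> = up (PX (Suc k) *v v)"
    using up_PX[of "Suc k"] assms by (intro PX_of_eigenvector) (auto simp: theta_Suc)
  finally show ?thesis by simp
qed

text \<open>\<open>Y\<close> and \<open>Z\<close> are linear combinations of \<open>up\<close> and
  \<open>down\<close>, hence they shift the weight index by exactly one.\<close>

lemma PX_YZ_PX:
  assumes "i \<le> CARD('n)" "i \<noteq> Suc j" "j \<noteq> Suc i"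
  shows "PX i *v (Y *v (PX j *v v)) = 0" "PX i *v (Z *v (PX j *v v)) = 0"
proof -
  let ?v = "PX j *v v"
  have "PX i *v up ?v = 0"
    by (rule PX_eigenvector_eq_0[OF X_up[OF PX_eigen]]) (use assms in \<open>auto simp: theta_plus_2_eq_iff\<close>)
  moreover have "PX i *v down ?v = 0"
    by (rule PX_eigenvector_eq_0[OF X_down[OF PX_eigen]]) (use assms in \<open>auto simp flip: theta_Suc\<close>)
  ultimately have *: "PX i *v (Y *v ?v) + \<i> *s (PX i *v (Z *v ?v)) = 0"
      "PX i *v (Y *v ?v) - \<i> *s (PX i *v (Z *v ?v)) = 0"
    by (simp_all add: up_def down_def matvec_linear)
  show "PX i *v (Y *v ?v) = 0" "PX i *v (Z *v ?v) = 0"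
    using * by (auto simp: vec_eq_iff complex_eq_iff)
qed

text \<open>\<open>Y\<close> and \<open>Z\<close> cannot jump over a missing index \<open>k\<close>,
  so the vectors supported below \<open>k\<close> would form a proper nonzero submodule.\<close>

lemma weights_eq: "weights PX W = {Min (weights PX W)..Max (weights PX W)}"
proof (rule ccontr)
  assume "weights PX W \<noteq> {Min (weights PX W)..Max (weights PX W)}"
  moreover have "weights PX W \<subseteq> {Min (weights PX W)..Max (weights PX W)}"
    using finite_weights by auto
  ultimately obtain k where k: "Min (weights PX W) \<le> k" "k \<le> Max (weights PX W)" "k \<notin> weights PX W"
    by (meson atLeastAtMost_iff subsetI subset_antisym)
  have Min: "Min (weights PX W) \<in> weights PX W" and Max: "Max (weights PX W) \<in> weights PX W"
    using Min_in Max_in finite_weights weights_nonempty by auto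
  then have k_bounds: "Min (weights PX W) < k" "k \<le> CARD('n)"
    using k by (auto simp: weights_def le_less)
  let ?U = "{w \<in> W. \<forall>i. k \<le> i \<longrightarrow> i \<le> CARD('n) \<longrightarrow> PX i *v w = 0}"
  have stable: "M *v w \<in> ?U"
    if M: "invariant M W" "\<And>i j v. \<lbrakk>i \<le> CARD('n); i \<noteq> Suc j; j \<noteq> Suc i\<rbrakk> \<Longrightarrow> PX i *v (M *v (PX j *v v)) = 0"
      and w: "w \<in> ?U" for M w
  proof -
    have Mw: "M *v w \<in> W" using M(1) w by (auto simp: invariant_def)
    have "PX i *v (M *v w) = 0" if i: "k \<le> i" "i \<le> CARD('n)" for i
    proof (cases "i = k")
      case True
      then show ?thesis using k(3) Mw i by (auto simp: weights_def)
    next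
      \<comment> \<open>Now \<open>i > k\<close>. Components of \<open>w\<close> with index
        \<open>j \<ge> k\<close> vanish, and an index \<open>j < k\<close> is at least two away from
        \<open>i\<close>.\<close>
      case False
      have "PX i *v (M *v (PX j *v w)) = 0" if "j \<le> CARD('n)" for j
        using w M(2)[of i j w] i False that by (cases "k \<le> j") auto
      then have "PX i *v (M *v (\<Sum>j\<le>CARD('n). PX j *v w)) = 0"
        by (simp add: matrix_vector_mult_sum)
      then show ?thesis by (simp add: PX_sum)
    qed
    then show ?thesis using Mw by auto
  qed
  have "?U = {0} \<or> ?U = W"
  proof (rule irred)
    show "vec.subspace ?U"
      using subspace unfolding vec.subspace_def by (auto simp: matvec_linear)
    show "invariant X ?U"
      by (auto simp: invariant_def PX_X W_closed)
    show "invariant Y ?U" "invariant Z ?U"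
      using stable[OF inv(2) PX_YZ_PX(1)] stable[OF inv(3) PX_YZ_PX(2)]
      unfolding invariant_def by blast+
  qed auto
  moreover have "?U \<noteq> {0}"
  proof -
    obtain v where v: "v \<in> W" "v \<noteq> 0" "X *v v = theta TYPE('n) (Min (weights PX W)) *s v"
      using weight_vector Min by metis
    have "v \<in> ?U"
      using v(1) PX_eigenvector_eq_0[OF v(3)] k_bounds by auto
    then show ?thesis using v(2) by auto
  qed
  ultimately have "?U = W" by blast
  then show False
    using Max k by (auto simp: weights_def)
qed

text \<open>Supplies \<open>d = CARD('n) - 2 * r\<close>, the diameter being defined by
  counting.\<close>

lemma card_weights: "card (weights PX W) = CARD('n) - 2 * Min (weights PX W) + 1"
proof -
  have "Min (weights PX W) \<le> Max (weights PX W)"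
    using Min_le[OF finite_weights Max_in[OF finite_weights weights_nonempty]] .
  moreover have "card (weights PX W) = Suc (Max (weights PX W)) - Min (weights PX W)"
    by (subst weights_eq) simp
  ultimately show ?thesis using Min_plus_Max_weights by simp
qed

text \<open>The Casimir element is symmetric in the triple, so the largest eigenvalues
  \<open>a\<close> of \<open>X\<close> and \<open>b\<close> of \<open>Y\<close> on \<open>W\<close>
  satisfy \<open>a^2 + 2 a = b^2 + 2 b\<close>; both are nonnegative, hence equal.\<close>

lemma Min_weights_rotate: "Min (weights PY W) = Min (weights PX W)"
proof -
  interpret rot: su2_module Y Z X PY PZ PX W by (rule rotate)
  obtain w where w: "w \<in> W" "w \<noteq> 0"
    using nonzero vec.subspace_0[OF subspace] by blast
  define a b where "a = int CARD('n) - 2 * int (Min (weights PX W))"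
    and "b = int CARD('n) - 2 * int (Min (weights PY W))"
  have "casimir w = rot.casimir w" by (simp add: casimir_def rot.casimir_def)
  then have "((theta TYPE('n) (Min (weights PX W)))\<^sup>2 + 2 * theta TYPE('n) (Min (weights PX W))) *s w
      = ((theta TYPE('n) (Min (weights PY W)))\<^sup>2 + 2 * theta TYPE('n) (Min (weights PY W))) *s w"
    using casimir_Min rot.casimir_Min w(1) by metis
  then have "(theta TYPE('n) (Min (weights PX W)))\<^sup>2 + 2 * theta TYPE('n) (Min (weights PX W))
      = (theta TYPE('n) (Min (weights PY W)))\<^sup>2 + 2 * theta TYPE('n) (Min (weights PY W))"
    using w(2) by (simp only: vec.scale_right_imp_eq vector_mul_rcancel) simp
  moreover have "theta TYPE('n) (Min (weights PX W)) = of_int a"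
      "theta TYPE('n) (Min (weights PY W)) = of_int b"
    by (simp_all add: theta_def a_def b_def)
  ultimately have "(of_int (a\<^sup>2 + 2 * a) :: complex) = of_int (b\<^sup>2 + 2 * b)"
    by simp
  then have "a\<^sup>2 + 2 * a = b\<^sup>2 + 2 * b"
    by (simp only: of_int_eq_iff)
  then have "(a - b) * (a + b + 2) = 0"
    by (simp add: algebra_simps power2_eq_square)
  \<comment> \<open>Twice the minimal index is at most \<open>Min + Max = CARD('n)\<close>.\<close>
  moreover have "a \<ge> 0" "b \<ge> 0"
    using Min_plus_Max_weights Min_le[OF finite_weights Max_in[OF finite_weights weights_nonempty]]
      rot.Min_plus_Max_weights Min_le[OF rot.finite_weights Max_in[OF rot.finite_weights rot.weights_nonempty]]
    by (simp_all add: a_def b_def)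
  ultimately show ?thesis by (simp add: a_def b_def)
qed

text \<open>The common form of the three claims, which arise from it by rotating the triple.\<close>

lemma hermitian_PX:
  assumes r: "r = Min (weights PX W)" and d: "d = CARD('n) - 2 * r" and ij: "i \<le> d" "j \<le> d"
    and uZ: "uZ \<in> mat_image (PZ r) W" and uY: "uY \<in> mat_image (PY r) W"
  shows "hermitian (PX (r + i) *v uZ) (PX (r + j) *v uY)
    = (if i = j then 1 else 0) * \<i> ^ i * of_nat (d choose i) * (1 + \<i>) powi (- int d) * hermitian uZ uY"
proof -
  interpret rY: su2_module Y Z X PY PZ PX W by (rule rotate)
  interpret rZ: su2_module Z X Y PZ PX PY W by (rule rY.rotate)
  have r_Y: "r = Min (weights PY W)" and r_Z: "r = Min (weights PZ W)"
    using r Min_weights_rotate rY.Min_weights_rotate by simp_all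
  have "Min (weights PX W) \<le> Max (weights PX W)"
    using Min_le[OF finite_weights Max_in[OF finite_weights weights_nonempty]] .
  then have D: "CARD('n) = d + 2 * r" and Max: "Max (weights PX W) = r + d"
    using Min_plus_Max_weights r d by auto
  have theta: "theta TYPE('n) (r + k) = of_nat d - 2 * of_nat k" for k
    by (simp add: theta_def D)
  have uZ: "uZ \<in> W" "Z *v uZ = of_nat d *s uZ" and uY: "uY \<in> W" "Y *v uY = of_nat d *s uY"
    using uZ uY rZ.W_closed(4) rY.W_closed(4) rZ.PX_eigen rY.PX_eigen theta[of 0]
    by (auto simp: mat_image_def)
  have "rZ.up uZ = 0" "rY.up uY = 0"
    using uZ uY theta[of 0] r_Y r_Z by (auto intro!: rZ.up_lowest rY.up_lowest)
  then have "X *v uZ + \<i> *s (Y *v uZ) = 0" "Z *v uY + \<i> *s (X *v uY) = 0"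
    by (simp_all add: rZ.up_def rY.up_def)
  \<comment> \<open>On \<open>uZ\<close> and \<open>uY\<close> the operators \<open>Y\<close> and
    \<open>Z\<close> are now multiples of \<open>X\<close>, which is diagonal on the
    components.\<close>
  then have YuZ: "Y *v uZ = \<i> *s (X *v uZ)" and ZuY: "Z *v uY = (- \<i>) *s (X *v uY)"
    by (auto simp: vec_eq_iff complex_eq_iff add_eq_0_iff)
  define f where "f k = hermitian (PX (r + k) *v uZ) uY" for k
  \<comment> \<open>Evaluate \<open>up (PX (r + Suc k) *v uZ)\<close> against \<open>uY\<close>
    twice: by moving \<open>Y\<close> and \<open>Z\<close> onto \<open>uY\<close>, and by moving
    \<open>up\<close> onto \<open>uZ\<close>.\<close>
  have rec: "of_nat (Suc k) * f (Suc k) = \<i> * of_nat (d - k) * f k" if k: "Suc k \<le> d" for k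
  proof -
    let ?v = "PX (r + Suc k) *v uZ"
    have Y: "hermitian (Y *v ?v) uY = of_nat d * f (Suc k)"
      using selfadj(2) by (simp add: selfadjoint_def uY hermitian_scale_right f_def)
    have Z: "hermitian (Z *v ?v) uY = \<i> * (of_nat d - 2 * of_nat (Suc k)) * f (Suc k)"
    proof -
      have "hermitian (Z *v ?v) uY = hermitian ?v (Z *v uY)"
        using selfadj(3) by (simp add: selfadjoint_def)
      \<comment> \<open>The second slot is conjugate-linear, which turns \<open>- \<i>\<close> into
        \<open>\<i>\<close>.\<close>
      also have "\<dots> = \<i> * hermitian ?v (X *v uY)"
        unfolding ZuY hermitian_scale_right by simp
      also have "hermitian ?v (X *v uY) = hermitian (X *v ?v) uY"
        using selfadj(1) by (simp add: selfadjoint_def)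
      finally show ?thesis
        unfolding PX_eigen theta hermitian_scale_left f_def by simp
    qed
    have "hermitian (up ?v) uY = 2 * of_nat (Suc k) * f (Suc k)"
      unfolding up_def hermitian_add_left hermitian_scale_left Y Z by (simp add: algebra_simps)
    moreover have "up ?v = (2 * \<i> * (of_nat d - of_nat k)) *s (PX (r + k) *v uZ)"
    proof -
      have "up ?v = PX (r + k) *v up uZ"
        using up_PX[of "r + k" uZ] k D by simp
      also have "up uZ = \<i> *s (X *v uZ) + (\<i> * of_nat d) *s uZ"
        by (simp add: up_def YuZ uZ)
      finally have up: "up ?v = \<i> *s (PX (r + k) *v (X *v uZ)) + (\<i> * of_nat d) *s (PX (r + k) *v uZ)"
        by (simp only: matvec_linear)
      have PX: "PX (r + k) *v (X *v uZ) = (of_nat d - 2 * of_nat k) *s (PX (r + k) *v uZ)"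
        using k D by (simp add: PX_X theta)
      show ?thesis unfolding up PX by (simp add: vec_eq_iff algebra_simps)
    qed
    ultimately have "2 * (of_nat (Suc k) * f (Suc k)) = 2 * (\<i> * of_nat (d - k) * f k)"
      using k by (simp add: hermitian_scale_left f_def mult.assoc of_nat_diff)
    then show ?thesis by (simp only: mult_cancel_left) simp
  qed
  have f: "f k = \<i> ^ k * of_nat (d choose k) * f 0" if "k \<le> d" for k
    using that
  proof (induction k)
    case (Suc k)
    have "of_nat (Suc k) * f (Suc k) = \<i> ^ Suc k * of_nat ((d - k) * (d choose k)) * f 0"
      using rec[of k] Suc by simp
    \<comment> \<open>Both sides equal \<open>d * (d - 1 choose k)\<close>.\<close>
    also have "(d - k) * (d choose k) = Suc k * (d choose Suc k)"
      using Suc.prems by (metis binomial_absorb_comp binomial_absorption mult.commute)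
    finally have "of_nat (Suc k) * f (Suc k) = of_nat (Suc k) * (\<i> ^ Suc k * of_nat (d choose Suc k) * f 0)"
      by (simp add: algebra_simps)
    then show ?case by (simp only: mult_cancel_left of_nat_eq_0_iff) simp
  qed simp
  have "uZ = (\<Sum>k\<le>CARD('n). PX k *v uZ)" by (simp add: PX_sum)
  also have "\<dots> = (\<Sum>k\<in>{r..r + d}. PX k *v uZ)"
  proof (intro sum.mono_neutral_right ballI)
    fix k assume k: "k \<in> {..CARD('n)} - {r..r + d}"
    then have "k \<notin> weights PX W"
      by (subst weights_eq) (simp add: Max flip: r)
    then show "PX k *v uZ = 0"
      using k uZ(1) by (auto simp: weights_def)
  qed (use D in auto)
  also have "\<dots> = (\<Sum>k\<le>d. PX (r + k) *v uZ)"
    using sum.shift_bounds_cl_nat_ivl[of "\<lambda>k. PX k *v uZ" 0 r d]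
    by (simp add: add.commute atMost_atLeast0)
  finally have "hermitian uZ uY = (\<Sum>k\<le>d. f k)"
    unfolding f_def by (metis hermitian_sum_left)
  also have "\<dots> = (\<Sum>k\<le>d. of_nat (d choose k) * \<i> ^ k) * f 0"
    unfolding sum_distrib_right by (intro sum.cong refl) (metis f atMost_iff mult.commute)
  also have "(\<Sum>k\<le>d. of_nat (d choose k) * \<i> ^ k) = (1 + \<i>) ^ d"
    using binomial_ring[of \<i> 1 d] by (simp add: add.commute)
  finally have f0: "hermitian uZ uY = (1 + \<i>) ^ d * f 0" .
  \<comment> \<open>Allows solving for \<open>f 0\<close>.\<close>
  have "1 + \<i> \<noteq> 0" by (simp add: complex_eq_iff)
  then have "f i = \<i> ^ i * of_nat (d choose i) * (1 + \<i>) powi (- int d) * hermitian uZ uY"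
    using f[OF ij(1)] by (simp add: f0 power_int_minus)
  moreover have "hermitian (PX (r + i) *v uZ) (PX (r + j) *v uY) = (if i = j then f i else 0)"
    using hermitian_PX_left[of "r + i" uZ "r + j" uY] ij D by (simp add: f_def)
  ultimately show ?thesis by auto
qed

end

subsection \<open>The triple of the cube\<close>

definition flip :: "'n::finite \<Rightarrow> 'n vertex \<Rightarrow> 'n vertex" where
  "flip k y = (\<chi> l. if l = k then \<not> y $ l else y $ l)"

definition wt :: "'n::finite vertex \<Rightarrow> nat" where
  "wt y = card {k. y $ k}"

lemma flip_nth: "flip k y $ l = (if l = k then \<not> y $ l else y $ l)"
  by (simp add: flip_def)

lemma flip_flip [simp]: "flip k (flip k y) = y"
  by (simp add: vec_eq_iff flip_nth)

lemma cube_adj_iff: "cube_adj y z \<longleftrightarrow> (\<exists>k. z = flip k y)"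
  unfolding cube_adj_def vec_eq_iff flip_nth by metis

lemma cube_adj_commute: "cube_adj y z \<longleftrightarrow> cube_adj z y"
  unfolding cube_adj_def by metis

lemma inj_flip: "inj (\<lambda>k. flip k y)"
  by (rule injI) (metis flip_nth)

lemma wt_le: "wt y \<le> CARD('n)" for y :: "'n::finite vertex"
  unfolding wt_def by (rule card_mono) auto

lemma wt_flip: "wt (flip k y) = (if y $ k then wt y - 1 else Suc (wt y))"
proof -
  have "{l. flip k y $ l} = (if y $ k then {l. y $ l} - {k} else insert k {l. y $ l})"
    by (auto simp: flip_nth)
  then show ?thesis by (simp add: wt_def)
qed

lemma wt_flip_True: "y $ k \<Longrightarrow> wt y = Suc (wt (flip k y))"
  using wt_flip[of k "flip k y"] by (simp add: flip_nth)

text \<open>Switching off the true coordinates one by one, read backwards, is a walk of length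
  \<open>wt y\<close>; no walk is shorter, since an edge raises \<open>wt\<close> by at most
  one.\<close>

lemma cube_dist_base: "cube_dist base_vertex y = wt y"
  unfolding cube_dist_def
proof (rule Least_equality)
  show "(base_vertex, y) \<in> {(a, b). cube_adj a b} ^^ wt y"
  proof (induction "wt y" arbitrary: y)
    case 0
    then have "{k. y $ k} = {}" by (simp add: wt_def)
    then show ?case by (auto simp: wt_def base_vertex_def vec_eq_iff)
  next
    case (Suc m)
    then have "{k. y $ k} \<noteq> {}" unfolding wt_def by (metis card.empty nat.distinct(1))
    then obtain k where k: "y $ k" by blast
    with Suc have "(base_vertex, flip k y) \<in> {(a, b). cube_adj a b} ^^ m"
      using wt_flip_True[OF k] by fastforce
    moreover have "cube_adj (flip k y) y"
      using flip_flip[of k y] unfolding cube_adj_iff by metis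
    ultimately show ?case using Suc(2) by (metis (no_types, lifting) case_prodI mem_Collect_eq relpow_Suc_I)
  qed
next
  show "wt y \<le> m" if "(base_vertex, y) \<in> {(a, b). cube_adj a b} ^^ m" for m
    using that
  proof (induction m arbitrary: y)
    case 0
    then show ?case by (auto simp: wt_def base_vertex_def)
  next
    case (Suc m)
    then obtain z where "(base_vertex, z) \<in> {(a, b). cube_adj a b} ^^ m" "cube_adj z y" by auto
    then show ?case using Suc.IH[of z] wt_flip[of _ z] by (auto simp: cube_adj_iff split: if_splits)
  qed
qed

section \<open>Entries of products with the three generators\<close>

lemma sum_cube_adj: "(\<Sum>z\<in>UNIV. (if cube_adj y z then f z else 0)) = (\<Sum>k\<in>UNIV. f (flip k y))"
  for f :: "'n::finite vertex \<Rightarrow> complex"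
proof -
  have "(\<Sum>z\<in>UNIV. (if cube_adj y z then f z else 0)) = (\<Sum>z\<in>range (\<lambda>k. flip k y). f z)"
    by (rule sum.mono_neutral_cong_right) (auto simp: cube_adj_iff)
  then show ?thesis by (simp add: sum.reindex[OF inj_flip])
qed

lemma A_mat_mult: "(A_mat ** M) $ y $ z = (\<Sum>k\<in>UNIV. M $ flip k y $ z)"
  using sum_cube_adj[of y "\<lambda>x. M $ x $ z"]
  by (simp add: matrix_matrix_mult_def A_mat_def if_distrib[of "\<lambda>a. a * _"] cong: if_cong)

lemma mult_A_mat: "(M ** A_mat) $ y $ z = (\<Sum>k\<in>UNIV. M $ y $ flip k z)"
  using sum_cube_adj[of z "\<lambda>x. M $ y $ x"]
  by (simp add: matrix_matrix_mult_def A_mat_def if_distrib[of "\<lambda>a. _ * a"] cube_adj_commute[of _ z] cong: if_cong)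

lemma Astar_mat_mult: "(Astar_mat ** M) $ y $ z = theta TYPE('n) (wt y) * M $ y $ z"
  for M :: "'n::finite cube_mat"
  by (simp add: matrix_matrix_mult_def Astar_mat_def theta_def cube_dist_base
      if_distrib[of "\<lambda>a. a * _"] cong: if_cong)

lemma mult_Astar_mat: "(M ** Astar_mat) $ y $ z = M $ y $ z * theta TYPE('n) (wt z)"
  for M :: "'n::finite cube_mat"
  by (simp add: matrix_matrix_mult_def Astar_mat_def theta_def cube_dist_base
      if_distrib[of "\<lambda>a. _ * a"] cong: if_cong)

text \<open>Writes the dual eigenvalue as a sum over coordinates, so that the intertwining relations
  with \<open>P_mat\<close> can be checked one coordinate at a time.\<close>

lemma theta_wt: "theta TYPE('n) (wt y) = (\<Sum>k\<in>UNIV. if y $ k then - 1 else 1)"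
  for y :: "'n::finite vertex"
proof -
  have "(\<Sum>k\<in>UNIV. if y $ k then - 1 else 1) = (\<Sum>k\<in>UNIV. 1 - 2 * (if y $ k then 1 else 0 :: complex))"
    by (intro sum.cong) auto
  also have "\<dots> = of_nat CARD('n) - 2 * (\<Sum>k\<in>UNIV. if y $ k then 1 else 0)"
    by (simp add: sum_subtractf sum_distrib_left)
  also have "(\<Sum>k\<in>UNIV. if y $ k then 1 else 0 :: complex) = of_nat (wt y)"
    by (simp add: wt_def sum.If_cases)
  finally show ?thesis by (simp add: theta_def)
qed

definition Aeps_mat :: "'n::finite cube_mat" where
  "Aeps_mat = cscale (- \<i> / 2) (A_mat ** Astar_mat - Astar_mat ** A_mat)"

lemma cscale_nth [simp]: "cscale c M $ y $ z = c * M $ y $ z"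
  by (simp add: cscale_def map_matrix_def)

lemma theta_wt_flip:
  "theta TYPE('n) (wt (flip k y)) = theta TYPE('n) (wt y) + (if y $ k then 2 else - 2)"
  for y :: "'n::finite vertex"
proof (cases "y $ k")
  case True
  then show ?thesis using wt_flip_True[OF True] by (simp add: theta_def)
next
  case False
  then show ?thesis by (simp add: wt_flip theta_def)
qed

text \<open>A commutator with a diagonal matrix scales each entry by a difference of diagonal
  values; across an edge that difference is \<open>2\<close> or \<open>- 2\<close>.\<close>

lemma Aeps_mat_nth:
  "Aeps_mat $ y $ z = (- \<i> / 2) * (theta TYPE('n) (wt z) - theta TYPE('n) (wt y)) * A_mat $ y $ z"
  for y :: "'n::finite vertex"
  by (simp add: Aeps_mat_def Astar_mat_mult mult_Astar_mat algebra_simps)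

lemma Aeps_mat_mult:
  "(Aeps_mat ** M) $ y $ z = (\<Sum>k\<in>UNIV. (if y $ k then - \<i> else \<i>) * M $ flip k y $ z)"
  for M :: "'n::finite cube_mat"
proof -
  have "(Aeps_mat ** M) $ y $ z = (\<Sum>x\<in>UNIV. if cube_adj y x
      then (- \<i> / 2) * (theta TYPE('n) (wt x) - theta TYPE('n) (wt y)) * M $ x $ z else 0)"
    unfolding matrix_matrix_mult_def vec_lambda_beta
    by (intro sum.cong) (auto simp: Aeps_mat_nth A_mat_def)
  also have "\<dots> = (\<Sum>k\<in>UNIV. (if y $ k then - \<i> else \<i>) * M $ flip k y $ z)"
    unfolding sum_cube_adj by (intro sum.cong) (auto simp: theta_wt_flip)
  finally show ?thesis .
qed

lemma mult_Aeps_mat: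
  "(M ** Aeps_mat) $ y $ z = (\<Sum>k\<in>UNIV. (if z $ k then \<i> else - \<i>) * M $ y $ flip k z)"
  for M :: "'n::finite cube_mat"
proof -
  have "(M ** Aeps_mat) $ y $ z = (\<Sum>x\<in>UNIV. if cube_adj z x
      then (- \<i> / 2) * (theta TYPE('n) (wt z) - theta TYPE('n) (wt x)) * M $ y $ x else 0)"
    unfolding matrix_matrix_mult_def vec_lambda_beta
    by (intro sum.cong) (auto simp: Aeps_mat_nth A_mat_def cube_adj_commute)
  also have "\<dots> = (\<Sum>k\<in>UNIV. (if z $ k then \<i> else - \<i>) * M $ y $ flip k z)"
    unfolding sum_cube_adj by (intro sum.cong) (auto simp: theta_wt_flip)
  finally show ?thesis .
qed

section \<open>Conjugation by \<open>P_mat\<close> and the commutation relations\<close>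

lemma P_mat_remove:
  "P_mat $ y $ z = P1_mat $ (y $ k) $ (z $ k) * (\<Prod>l\<in>UNIV - {k}. P1_mat $ (y $ l) $ (z $ l))"
  by (simp add: P_mat_def prod.remove)

lemma P_mat_flip_left:
  "P_mat $ flip k y $ z = P1_mat $ (\<not> y $ k) $ (z $ k) * (\<Prod>l\<in>UNIV - {k}. P1_mat $ (y $ l) $ (z $ l))"
  unfolding P_mat_remove[of _ _ k] by (simp add: flip_nth)

lemma P_mat_flip_right:
  "P_mat $ y $ flip k z = P1_mat $ (y $ k) $ (\<not> z $ k) * (\<Prod>l\<in>UNIV - {k}. P1_mat $ (y $ l) $ (z $ l))"
  unfolding P_mat_remove[of _ _ k] by (simp add: flip_nth)

text \<open>Both sides are sums over coordinates that agree term by term: once the other factors are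
  split off, each term is an identity between entries of \<open>P1_mat\<close>.\<close>

lemma P_A: "P_mat ** A_mat = Astar_mat ** P_mat"
  unfolding vec_eq_iff mult_A_mat Astar_mat_mult theta_wt sum_distrib_right
proof (intro allI sum.cong refl)
  fix y z :: "'a vertex" and k
  show "P_mat $ y $ flip k z = (if y $ k then - 1 else 1) * P_mat $ y $ z"
    unfolding P_mat_flip_right P_mat_remove[of y z k] by (auto simp: P1_mat_def)
qed

lemma P_Aeps: "P_mat ** Aeps_mat = A_mat ** P_mat"
  unfolding vec_eq_iff mult_Aeps_mat A_mat_mult
  by (intro allI sum.cong) (auto simp: P_mat_flip_left P_mat_flip_right P1_mat_def)

lemma P_Astar: "P_mat ** Astar_mat = Aeps_mat ** P_mat"
  unfolding vec_eq_iff Aeps_mat_mult mult_Astar_mat theta_wt sum_distrib_left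
proof (intro allI sum.cong refl)
  fix y z :: "'a vertex" and k
  show "P_mat $ y $ z * (if z $ k then - 1 else 1) = (if y $ k then - \<i> else \<i>) * P_mat $ flip k y $ z"
    unfolding P_mat_flip_left P_mat_remove[of y z k] by (auto simp: P1_mat_def)
qed

lemma sum_prod_vertex:
  "(\<Sum>z\<in>UNIV. \<Prod>k\<in>UNIV. g k (z $ k)) = (\<Prod>k\<in>UNIV. g k True + g k False)"
  for g :: "'n::finite \<Rightarrow> bool \<Rightarrow> complex"
proof -
  have "(\<Prod>k\<in>UNIV. g k True + g k False) = (\<Prod>k\<in>UNIV. \<Sum>b\<in>UNIV. g k b)"
    by (simp add: UNIV_bool add.commute)
  also have "\<dots> = (\<Sum>h\<in>UNIV. \<Prod>k\<in>UNIV. g k (h k))"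
    using prod_sum_PiE[of "UNIV :: 'n set" "\<lambda>_. UNIV" g] by simp
  also have "\<dots> = (\<Sum>z\<in>UNIV. \<Prod>k\<in>UNIV. g k (z $ k))"
    by (rule sum.reindex_bij_witness[of _ "\<lambda>z. vec_nth z" "\<lambda>h. vec_lambda h"])
      (simp_all add: fun_eq_iff)
  finally show ?thesis by simp
qed

lemma P_mat_invertible: "invertible (P_mat :: 'n::finite cube_mat)"
proof -
  \<comment> \<open>Kronecker power of half the conjugate transpose of \<open>P1_mat\<close>, whose
    rows are orthogonal of squared norm 2.\<close>
  define R :: "'n cube_mat" where "R = (\<chi> y z. \<Prod>k\<in>UNIV. cnj (P1_mat $ (z $ k) $ (y $ k)) / 2)"
  have "(P_mat ** R) $ y $ z = (if y = z then 1 else 0)" for y z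
  proof -
    have "(P_mat ** R) $ y $ z
        = (\<Sum>x\<in>UNIV. \<Prod>k\<in>UNIV. P1_mat $ (y $ k) $ (x $ k) * cnj (P1_mat $ (z $ k) $ (x $ k)) / 2)"
      by (simp add: matrix_matrix_mult_def P_mat_def R_def flip: prod.distrib)
    also have "\<dots> = (\<Prod>k\<in>UNIV. if y $ k = z $ k then 1 else 0)"
      using sum_prod_vertex[of "\<lambda>k b. P1_mat $ (y $ k) $ b * cnj (P1_mat $ (z $ k) $ b) / 2"]
      by (auto simp: P1_mat_def intro!: prod.cong)
    also have "\<dots> = (if y = z then 1 else 0)"
      by (auto simp: vec_eq_iff)
    finally show ?thesis .
  qed
  then have "P_mat ** R = mat 1" by (simp add: vec_eq_iff mat_def)
  then show ?thesis by (metis invertible_def matrix_left_right_inverse)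
qed

definition P_conj :: "'n::finite cube_mat \<Rightarrow> 'n cube_mat" where
  "P_conj M = matrix_inv P_mat ** M ** P_mat"

lemma matrix_inv_P: "matrix_inv P_mat ** P_mat = mat 1" "P_mat ** matrix_inv P_mat = mat 1"
  using someI_ex[OF P_mat_invertible[unfolded invertible_def]] by (auto simp: matrix_inv_def)

lemma P_conj_mult: "P_conj (M ** N) = P_conj M ** P_conj N"
  unfolding P_conj_def
  by (metis (no_types, lifting) matrix_inv_P(2) matrix_mul_assoc matrix_mul_rid)

lemma P_conj_1: "P_conj (mat 1) = mat 1"
  by (simp add: P_conj_def matrix_inv_P)

lemma matrix_mult_diff: "M ** (N - K) = M ** N - M ** K" "(M - N) ** K = M ** K - N ** K"
  for M :: "'n::finite cube_mat"
  by (simp_all add: vec_eq_iff matrix_matrix_mult_def right_diff_distrib left_diff_distrib sum_subtractf)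

lemma P_conj_diff: "P_conj (M - N) = P_conj M - P_conj N"
  by (simp add: P_conj_def matrix_mult_diff)

lemma cscale_mult: "cscale c M ** N = cscale c (M ** N)" "M ** cscale c N = cscale c (M ** N)"
  by (simp_all add: vec_eq_iff matrix_matrix_mult_def sum_distrib_left mult_ac)

lemma P_conj_cscale: "P_conj (cscale c M) = cscale c (P_conj M)"
  by (simp add: P_conj_def cscale_mult)

lemma P_conj_eq:
  assumes "P_mat ** M = N ** P_mat"
  shows "P_conj N = M"
  unfolding P_conj_def using assms
  by (metis matrix_inv_P(1) matrix_mul_assoc matrix_mul_lid)

lemma P_conj_generators: "P_conj Astar_mat = A_mat" "P_conj A_mat = Aeps_mat" "P_conj Aeps_mat = Astar_mat"
  by (simp_all add: P_conj_eq P_A P_Aeps P_Astar)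

lemma A_Astar_comm: "A_mat ** Astar_mat - Astar_mat ** A_mat = cscale (2 * \<i>) Aeps_mat"
  by (simp add: vec_eq_iff Aeps_mat_def)

text \<open>Conjugating the defining commutator permutes the generators cyclically; a second
  conjugation gives the remaining relation.\<close>

lemma Aeps_A_comm: "Aeps_mat ** A_mat - A_mat ** Aeps_mat = cscale (2 * \<i>) Astar_mat"
  using arg_cong[OF A_Astar_comm, of P_conj]
  by (simp add: P_conj_diff P_conj_mult P_conj_cscale P_conj_generators)

lemma Astar_Aeps_comm: "Astar_mat ** Aeps_mat - Aeps_mat ** Astar_mat = cscale (2 * \<i>) A_mat"
  using arg_cong[OF Aeps_A_comm, of P_conj]
  by (simp add: P_conj_diff P_conj_mult P_conj_cscale P_conj_generators)

section \<open>Primitive idempotents as Lagrange polynomials\<close>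

definition lagrange :: "'n::finite cube_mat \<Rightarrow> nat \<Rightarrow> nat list \<Rightarrow> 'n cube_mat" where
  "lagrange X i js = foldr
     (\<lambda>j M. cscale (1 / (theta TYPE('n) i - theta TYPE('n) j)) (X - cscale (theta TYPE('n) j) (mat 1)) ** M)
     js (mat 1)"

text \<open>With the matrix made a parameter, all three families of idempotents become one
  polynomial in three matrices.\<close>

lemma E_mat_eq: "(E_mat i :: 'n::finite cube_mat) = lagrange A_mat i (filter (\<lambda>j. j \<noteq> i) [0..<Suc CARD('n)])"
  by (simp add: E_mat_def lagrange_def)

lemma P_conj_lagrange: "P_conj (lagrange X i js) = lagrange (P_conj X) i js"
  by (induction js) (simp_all add: lagrange_def P_conj_1 P_conj_mult P_conj_cscale P_conj_diff)

lemma lagrange_Astar: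
  fixes y z :: "'n::finite vertex"
  shows "lagrange Astar_mat i js $ y $ z = (if y = z then
    (\<Prod>j\<leftarrow>js. (theta TYPE('n) (wt y) - theta TYPE('n) j) / (theta TYPE('n) i - theta TYPE('n) j)) else 0)"
proof (induction js)
  case (Cons j js)
  then show ?case
    by (simp add: lagrange_def matrix_mult_diff cscale_mult Astar_mat_mult diff_divide_distrib left_diff_distrib)
qed (simp add: lagrange_def mat_def)

text \<open>On the diagonal the Lagrange polynomial is evaluated at \<open>theta (wt y)\<close>, one
  of its nodes.\<close>

lemma Estar_mat_eq:
  "(Estar_mat i :: 'n::finite cube_mat) = lagrange Astar_mat i (filter (\<lambda>j. j \<noteq> i) [0..<Suc CARD('n)])"
proof -
  define js where "js = filter (\<lambda>j. j \<noteq> i) [0..<Suc CARD('n)]"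
  define q where "q k j = (theta TYPE('n) k - theta TYPE('n) j) / (theta TYPE('n) i - theta TYPE('n) j)" for k j
  have js: "set js = {..CARD('n)} - {i}"
    by (auto simp: js_def simp del: upt_Suc)
  have "(\<Prod>j\<leftarrow>js. q k j) = (if k = i then 1 else 0)" if "k \<le> CARD('n)" for k
  proof (cases "k = i")
    case True
    have "map (q i) js = map (\<lambda>j. 1) js"
      by (intro map_cong) (auto simp: js q_def)
    then show ?thesis using True by (simp add: map_replicate_const)
  next
    case False
    \<comment> \<open>The factor with \<open>j = k\<close> vanishes; \<open>k\<close> is in the list
      because \<open>k \<le> CARD('n)\<close> and \<open>k \<noteq> i\<close>.\<close>
    then have "0 \<in> set (map (q k) js)"
      using that by (auto simp: js q_def image_iff intro!: bexI[of _ k])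
    then show ?thesis using False by (simp add: prod_list_zero_iff)
  qed
  then have "Estar_mat i $ y $ z = lagrange Astar_mat i js $ y $ z" for y z :: "'n vertex"
    unfolding lagrange_Astar q_def[symmetric] by (auto simp: Estar_mat_def cube_dist_base wt_le)
  then show ?thesis
    unfolding js_def[symmetric] by (simp add: vec_eq_iff)
qed

lemma P_conj_Estar: "P_conj (Estar_mat i) = E_mat i"
  by (simp add: Estar_mat_eq E_mat_eq P_conj_lagrange P_conj_generators)

lemma Eeps_mat_conj: "Eeps_mat i = P_conj (E_mat i)"
  by (simp add: Eeps_mat_def P_conj_def)

lemma Eeps_mat_eq:
  "(Eeps_mat i :: 'n::finite cube_mat) = lagrange Aeps_mat i (filter (\<lambda>j. j \<noteq> i) [0..<Suc CARD('n)])"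
  by (simp add: Eeps_mat_conj E_mat_eq P_conj_lagrange P_conj_generators)

lemma cscale_mult_vec: "cscale c M *v v = c *s (M *v v)"
  by (simp add: vec_eq_iff matrix_vector_mult_def sum_distrib_left mult_ac)

lemma eigenprojections_Astar: "eigenprojections Astar_mat Estar_mat"
proof -
  have Estar: "(Estar_mat i *v v) $ y = (if wt y = i then v $ y else 0)" for i and v :: "'a cube_vec" and y
    by (simp add: matrix_vector_mult_def Estar_mat_def cube_dist_base if_distrib[of "\<lambda>a. a * _"] cong: if_cong)
  have Astar: "(Astar_mat *v v) $ y = theta TYPE('a) (wt y) * v $ y" for v :: "'a cube_vec" and y
    by (simp add: matrix_vector_mult_def Astar_mat_def theta_def cube_dist_base if_distrib[of "\<lambda>a. a * _"] cong: if_cong)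
  show ?thesis
    unfolding eigenprojections_def
    by (simp add: vec_eq_iff Estar Astar wt_le)
qed

text \<open>Only the diagonal family is verified directly; conjugating once and twice transports its
  properties to \<open>A_mat\<close> and \<open>Aeps_mat\<close>.\<close>

lemma eigenprojections_P_conj:
  assumes "eigenprojections X E"
  shows "eigenprojections (P_conj X) (\<lambda>i. P_conj (E i))"
proof -
  have P: "P_mat *v (matrix_inv P_mat *v v) = v" "matrix_inv P_mat *v (P_mat *v v) = v" for v :: "'a cube_vec"
    by (simp_all add: matrix_vector_mul_assoc matrix_inv_P)
  have conj: "P_conj M *v v = matrix_inv P_mat *v (M *v (P_mat *v v))" for M and v :: "'a cube_vec"
    by (simp add: P_conj_def matrix_vector_mul_assoc matrix_mul_assoc)
  show ?thesis
    using assms unfolding eigenprojections_def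
    by (simp add: conj P vector_scalar_commute if_distrib[of "\<lambda>v. matrix_inv P_mat *v v"]
        flip: matrix_vector_mult_sum)
qed

lemma eigenprojections_A: "eigenprojections A_mat E_mat"
  using eigenprojections_P_conj[OF eigenprojections_Astar] by (simp add: P_conj_generators P_conj_Estar)

lemma eigenprojections_Aeps: "eigenprojections Aeps_mat Eeps_mat"
  using eigenprojections_P_conj[OF eigenprojections_A] by (simp add: P_conj_generators flip: Eeps_mat_conj)

section \<open>Self-adjointness, invariant subspaces and T-modules\<close>

lemma selfadjointI:
  assumes "\<And>y z. cnj (M $ y $ z) = M $ z $ y"
  shows "selfadjoint M"
  unfolding selfadjoint_def
proof (intro allI)
  fix v w
  have "hermitian (M *v v) w = (\<Sum>y\<in>UNIV. \<Sum>z\<in>UNIV. M $ y $ z * v $ z * cnj (w $ y))"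
    by (simp add: hermitian_def matrix_vector_mult_def sum_distrib_right)
  also have "\<dots> = (\<Sum>z\<in>UNIV. \<Sum>y\<in>UNIV. M $ y $ z * v $ z * cnj (w $ y))"
    by (rule sum.swap)
  also have "\<dots> = hermitian v (M *v w)"
    by (simp add: hermitian_def matrix_vector_mult_def sum_distrib_left assms mult_ac)
  finally show "hermitian (M *v v) w = hermitian v (M *v w)" .
qed

lemma selfadjoint_A: "selfadjoint A_mat"
  by (rule selfadjointI) (simp add: A_mat_def cube_adj_commute)

lemma selfadjoint_Astar: "selfadjoint Astar_mat"
  by (rule selfadjointI) (simp add: Astar_mat_def)

lemma selfadjoint_Aeps: "selfadjoint Aeps_mat"
proof (rule selfadjointI)
  fix y z :: "'a vertex"
  show "cnj (Aeps_mat $ y $ z) = Aeps_mat $ z $ y"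
    unfolding Aeps_mat_nth by (simp add: A_mat_def cube_adj_commute[of z y] algebra_simps)
qed

lemma invariant_closure:
  assumes "vec.subspace U"
  shows "invariant (mat 1) U"
    and "\<lbrakk>invariant B U; invariant C U\<rbrakk> \<Longrightarrow> invariant (B + C) U"
    and "\<lbrakk>invariant B U; invariant C U\<rbrakk> \<Longrightarrow> invariant (B - C) U"
    and "invariant B U \<Longrightarrow> invariant (cscale c B) U"
    and "\<lbrakk>invariant B U; invariant C U\<rbrakk> \<Longrightarrow> invariant (B ** C) U"
  using assms
  by (auto simp: invariant_def cscale_mult_vec matrix_vector_mult_add_rdistrib
      matrix_vector_mult_diff_rdistrib vec.subspace_add vec.subspace_diff vec.subspace_scale
      simp flip: matrix_vector_mul_assoc)

lemma subalgebra_invariant: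
  assumes "vec.subspace U"
  shows "subalgebra {B. invariant B U}"
  using invariant_closure[OF assms] by (simp add: subalgebra_def)

lemma invariant_lagrange:
  assumes "vec.subspace U" "invariant X U"
  shows "invariant (lagrange X i js) U"
  unfolding lagrange_def
  by (induction js) (simp_all add: invariant_closure[OF assms(1)] assms(2))

lemma invariant_Aeps:
  assumes "vec.subspace U" "invariant A_mat U" "invariant Astar_mat U"
  shows "invariant Aeps_mat U"
  unfolding Aeps_mat_def by (intro invariant_closure assms)

text \<open>The matrices preserving a subspace form a subalgebra, so invariance under the generators
  extends to all of \<open>T_alg\<close>.\<close>

lemma T_module_iff:
  fixes U :: "'n::finite cube_vec set"
  shows "T_module U \<longleftrightarrow> vec.subspace U \<and> invariant A_mat U \<and> invariant Astar_mat U"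
proof
  assume "T_module U"
  moreover have "(A_mat :: 'n cube_mat) \<in> T_alg" "(Astar_mat :: 'n cube_mat) \<in> T_alg"
    unfolding T_alg_def by (simp_all add: hull_inc)
  ultimately show "vec.subspace U \<and> invariant A_mat U \<and> invariant Astar_mat U"
    by (simp add: T_module_def invariant_def)
next
  assume U: "vec.subspace U \<and> invariant A_mat U \<and> invariant Astar_mat U"
  then have "T_alg \<subseteq> {B. invariant B U}"
    unfolding T_alg_def by (intro hull_minimal subalgebra_invariant) auto
  then show "T_module U"
    using U by (auto simp: T_module_def invariant_def)
qed

lemma commutator_vec:
  assumes "M ** N - N ** M = cscale c K"
  shows "M *v (N *v v) = N *v (M *v v) + c *s (K *v v)"
  using arg_cong[OF assms, of "\<lambda>B. B *v v"]
  by (simp add: matrix_vector_mult_diff_rdistrib cscale_mult_vec matrix_vector_mul_assoc algebra_simps)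

text \<open>Invariance under \<open>A_mat\<close> and \<open>Astar_mat\<close> entails invariance
  under \<open>Aeps_mat\<close>, so irreducibility over \<open>T_alg\<close> is irreducibility for
  the triple.\<close>

lemma su2_module_cube:
  assumes "irreducible_T_module W"
  shows "su2_module A_mat Astar_mat Aeps_mat E_mat Estar_mat Eeps_mat W"
proof -
  have W: "vec.subspace W" "invariant A_mat W" "invariant Astar_mat W"
    using assms by (auto simp: irreducible_T_module_def T_module_iff)
  show ?thesis
  proof
    show "U = {0} \<or> U = W" if "vec.subspace U" "invariant A_mat U" "invariant Astar_mat U" "U \<subseteq> W" for U
      using assms that by (simp add: irreducible_T_module_def T_module_iff)
    show "W \<noteq> {0}" using assms by (simp add: irreducible_T_module_def)
  qed (simp_all add: W invariant_Aeps invariant_lagrange E_mat_eq Estar_mat_eq Eeps_mat_eq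
      eigenprojections_A eigenprojections_Astar eigenprojections_Aeps
      selfadjoint_A selfadjoint_Astar selfadjoint_Aeps commutator_vec
      A_Astar_comm Astar_Aeps_comm Aeps_A_comm)
qed

text \<open>The image of a subspace always contains 0, so being different from \<open>{0}\<close>
  means having a nonzero element.\<close>

lemma dual_support_eq_weights:
  assumes "vec.subspace W"
  shows "dual_support W = weights Estar_mat W"
proof -
  have "mat_image M W = {0} \<longleftrightarrow> (\<forall>w\<in>W. M *v w = 0)" for M
  proof -
    have "0 = M *v 0" by simp
    then have "0 \<in> mat_image M W"
      using vec.subspace_0[OF assms] unfolding mat_image_def by (rule image_eqI)
    moreover have "mat_image M W \<subseteq> {0} \<longleftrightarrow> (\<forall>w\<in>W. M *v w = 0)"
      by (simp add: mat_image_def image_subset_iff)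
    ultimately show ?thesis by blast
  qed
  then show ?thesis by (simp add: dual_support_def weights_def)
qed

theorem theorem11p4:
  fixes W :: "'n::finite cube_vec set"
    and u ustar ueps :: "'n cube_vec"
    and r d i j :: nat
  assumes "irreducible_T_module W"
    and "r = endpoint W"
    and "d = diameter_T W"
    and "i \<le> d" and "j \<le> d"
    and "u \<in> mat_image (E_mat r) W" and "u \<noteq> 0"
    and "ustar \<in> mat_image (Estar_mat r) W" and "ustar \<noteq> 0"
    and "ueps \<in> mat_image (Eeps_mat r) W" and "ueps \<noteq> 0"
  shows
    "hermitian (E_mat (r + i) *v ueps) (E_mat (r + j) *v ustar)
       = (if i = j then 1 else 0) * \<i> ^ i * of_nat (d choose i) * (1 + \<i>) powi (- int d)
         * hermitian ueps ustar
     \<and> hermitian (Estar_mat (r + i) *v u) (Estar_mat (r + j) *v ueps)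
       = (if i = j then 1 else 0) * \<i> ^ i * of_nat (d choose i) * (1 + \<i>) powi (- int d)
         * hermitian u ueps
     \<and> hermitian (Eeps_mat (r + i) *v ustar) (Eeps_mat (r + j) *v u)
       = (if i = j then 1 else 0) * \<i> ^ i * of_nat (d choose i) * (1 + \<i>) powi (- int d)
         * hermitian ustar u"
proof -
  interpret A: su2_module A_mat Astar_mat Aeps_mat E_mat Estar_mat Eeps_mat W
    using assms(1) by (rule su2_module_cube)
  interpret Astar: su2_module Astar_mat Aeps_mat A_mat Estar_mat Eeps_mat E_mat W
    by (rule A.rotate)
  interpret Aeps: su2_module Aeps_mat A_mat Astar_mat Eeps_mat E_mat Estar_mat W
    by (rule Astar.rotate)
  have r: "r = Min (weights Estar_mat W)" and d: "d = CARD('n) - 2 * r"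
    using assms(2,3) Astar.card_weights
    by (simp_all add: endpoint_def diameter_T_def dual_support_eq_weights[OF A.subspace])
  \<comment> \<open>The three rotations give (i), (ii) and (iii) in turn;
    \<open>Min_weights_rotate\<close> makes \<open>r\<close> the least weight index for each of
    them.\<close>
  show ?thesis
    using r A.Min_weights_rotate Astar.Min_weights_rotate
      A.hermitian_PX[OF _ d assms(4,5,10,8)] Astar.hermitian_PX[OF _ d assms(4,5,6,10)]
      Aeps.hermitian_PX[OF _ d assms(4,5,8,6)]
    by simp
qed

end
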